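(* Let $r\ge 1$ be an integer and let $R=\mathbb{R}[x,y,z]$ with its standard grading. Let $$I_1=\langle x^{r+1},(x+y)^{r+1},y^{r+1}\rangle,\qquad I_2=\langle z^{r+1},(z+y)^{r+1},y^{r+1}\rangle$$ be ideals of $R$. Let $(A_1,B_1,C_1)^T,(D_1,E_1,F_1)^T\in R^3$ be a homogeneous basis of the (free, rank two) module of syzygies on $(x^{r+1},(x+y)^{r+1},y^{r+1})$, and let $(A_2,B_2,C_2)^T,(D_2,E_2,F_2)^T\in R^3$ be a homogeneous basis of the (free, rank two) module of syzygies on $(z^{r+1},(z+y)^{r+1},y^{r+1})$. Then the Hilbert function of $R/\langle C_1,F_1,C_2,F_2\rangle$ is nonzero in degree $r-1$, i.e. $$\dim_{\mathbb{R}}\left(R/\langle C_1,F_1,C_2,F_2\rangle\right)_{r-1}\neq 0 .$$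
   Context: A syzygy on $(g_1,g_2,g_3)$, $g_i\in R$, is a column $(a_1,a_2,a_3)^T\in R^3$ with $a_1g_1+a_2g_2+a_3g_3=0$. The two syzygy bases are the columns of the matrices in the minimal free resolutions $$0\to R^2\xrightarrow{\begin{bmatrix} A_i & D_i \\ B_i & E_i \\ C_i & F_i \end{bmatrix}}R^3\to R\to R/I_i\to 0,\qquad i=1,2,$$ where the map $R^3\to R$ is given by the row of the listed generators of $I_i$, in the listed order. Thus $C_i,F_i$ are the coefficients of $y^{r+1}$ in the two basis syzygies. "Homogeneous basis" means that in each basis syzygy all entries are homogeneous of one common degree (entries may be zero). For a graded $R$-module $M$, its Hilbert function in degree $k$ is $\dim_{\mathbb{R}}M_k$. *)

theory Defs
  imports
    "HOL-Library.Poly_Mapping"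
    "HOL-Library.Numeral_Type"
    "HOL-Library.Product_Plus"
    "HOL-Algebra.QuotRing"
    "HOL-Algebra.Embedded_Algebras"
    "HOL-Algebra.Algebraic_Closure_Type"
begin

text \<open>
  Real polynomials in three variables: finitely supported maps from exponent vectors (indexed by
  the three-element type \<open>3\<close>) to coefficients, with the convolution product of \<open>Poly_Mapping\<close>.
  The elements of the index type are written \<open>0, 1, 2\<close>.
\<close>

type_synonym rpoly = "(3 \<Rightarrow>\<^sub>0 nat) \<Rightarrow>\<^sub>0 real"

definition var :: "3 \<Rightarrow> rpoly"
  where "var i = Poly_Mapping.single (Poly_Mapping.single i 1) 1"

definition vx :: rpoly where "vx = var 0"
definition vy :: rpoly where "vy = var 1"
definition vz :: rpoly where "vz = var 2"

definition const_poly :: "real \<Rightarrow> rpoly"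
  where "const_poly c = Poly_Mapping.single 0 c"

text \<open>The graded piece of degree \<open>d\<close>; it contains the zero polynomial.\<close>

definition graded_piece :: "nat \<Rightarrow> rpoly set"
  where "graded_piece d =
    {p. \<forall>m \<in> Poly_Mapping.keys p. (\<Sum>i\<in>UNIV. Poly_Mapping.lookup m i) = d}"

type_synonym column = "rpoly \<times> rpoly \<times> rpoly"

fun column_scale :: "rpoly \<Rightarrow> column \<Rightarrow> column"
  where "column_scale p (a, b, c) = (p * a, p * b, p * c)"

interpretation column: Modules.module column_scale
  by unfold_locales (auto simp: algebra_simps)

fun row_times_column :: "rpoly \<times> rpoly \<times> rpoly \<Rightarrow> column \<Rightarrow> rpoly"
  where "row_times_column (g1, g2, g3) (a1, a2, a3) = a1 * g1 + a2 * g2 + a3 * g3"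

definition syzygies :: "rpoly \<times> rpoly \<times> rpoly \<Rightarrow> column set"
  where "syzygies g = {s. row_times_column g s = 0}"

fun homogeneous_column :: "column \<Rightarrow> bool"
  where "homogeneous_column (a, b, c) \<longleftrightarrow>
    (\<exists>d. a \<in> graded_piece d \<and> b \<in> graded_piece d \<and> c \<in> graded_piece d)"

text \<open>
  \<open>u \<noteq> v\<close> is required because independence is a property of the set \<open>{u, v}\<close>.
\<close>

definition homogeneous_syzygy_basis ::
    "rpoly \<times> rpoly \<times> rpoly \<Rightarrow> column \<Rightarrow> column \<Rightarrow> bool"
  where "homogeneous_syzygy_basis g u v \<longleftrightarrow>
    homogeneous_column u \<and> homogeneous_column v \<and>
    u \<noteq> v \<and> column.independent {u, v} \<and> column.span {u, v} = syzygies g"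

abbreviation Rxyz :: "rpoly ring"
  where "Rxyz \<equiv> ring_of_type_algebra"

text \<open>
  For a homogeneous ideal \<open>J\<close>, the degree-\<open>k\<close> piece of \<open>Rxyz Quot J\<close> is the image of the degree-\<open>k\<close> piece
  of \<open>Rxyz\<close> under the projection \<open>p \<mapsto> J + p\<close>. The real scalars act on \<open>Rxyz Quot J\<close> through the images of the
  constant polynomials, so those images serve as the field of scalars in \<^const>\<open>ring.dim\<close>.
\<close>

definition quotient_graded_piece :: "rpoly set \<Rightarrow> nat \<Rightarrow> rpoly set set"
  where "quotient_graded_piece J k = (\<lambda>p. J +>\<^bsub>Rxyz\<^esub> p) ` graded_piece k"

definition hilbert_function_quotient :: "rpoly set \<Rightarrow> nat \<Rightarrow> nat"
  where "hilbert_function_quotient J k =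
    ring.dim (Rxyz Quot J) (range (\<lambda>c. J +>\<^bsub>Rxyz\<^esub> const_poly c)) (quotient_graded_piece J k)"

end

theory Submission
  imports Defs "HOL-Computational_Algebra.Polynomial"
begin

text \<open>
  Setting \<open>z = x\<close> maps \<open>C\<^sub>2\<close> and \<open>F\<^sub>2\<close>, like \<open>C\<^sub>1\<close> and \<open>F\<^sub>1\<close>, to polynomials whose product with
  \<open>y^(r+1)\<close> lies in \<open>\<langle>x^(r+1), (x+y)^(r+1)\<rangle>\<close>. So it suffices that \<open>x^(r-1) y^(r+1)\<close> does not lie in
  that ideal of \<open>\<real>[x,y]\<close>. Otherwise, dehomogenizing in degree \<open>2r\<close> gives
  \<open>t^(r-1) = a t^(r+1) + b (1+t)^(r+1)\<close> with \<open>deg b \<le> r - 1\<close>; hence \<open>b = c t^(r-1)\<close> with \<open>c\<close> constant, and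
  \<open>1 = a' t^2 + c (1+t)^(r+1)\<close>, which is impossible: the constant terms force \<open>c = 1\<close>, the linear
  ones \<open>c = 0\<close>.
\<close>

section \<open>Monomial degrees and induction over terms\<close>

definition total_degree :: "(3 \<Rightarrow>\<^sub>0 nat) \<Rightarrow> nat"
  where "total_degree m = (\<Sum>i\<in>UNIV. Poly_Mapping.lookup m i)"

lemma total_degree_add [simp]: "total_degree (m + n) = total_degree m + total_degree n"
  by (simp add: total_degree_def lookup_add sum.distrib)

lemma total_degree_zero [simp]: "total_degree 0 = 0"
  by (simp add: total_degree_def)

lemma total_degree_single [simp]: "total_degree (Poly_Mapping.single i k) = k"
  by (simp add: total_degree_def lookup_single when_def)

lemma lookup_02_le_total_degree: "Poly_Mapping.lookup m 0 + Poly_Mapping.lookup m 2 \<le> total_degree m"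
proof -
  have "Poly_Mapping.lookup m 0 + Poly_Mapping.lookup m 2 = (\<Sum>i\<in>{0,2}. Poly_Mapping.lookup m i)" by simp
  also have "\<dots> \<le> total_degree m"
    unfolding total_degree_def by (rule sum_mono2) auto
  finally show ?thesis .
qed

lemma poly_mapping_eq_sum_single:
  fixes p :: "'a \<Rightarrow>\<^sub>0 'b::comm_monoid_add"
  shows "p = (\<Sum>m\<in>Poly_Mapping.keys p. Poly_Mapping.single m (Poly_Mapping.lookup p m))"
  by (rule poly_mapping_eqI)
    (auto simp: lookup_sum lookup_single when_def in_keys_iff)

text \<open>Reduces a property closed under addition to single terms. Applied to each factor in
  turn, it turns multiplicativity of \<open>collapse\<close> into addition of exponents.\<close>

lemma poly_mapping_additive_induct [case_names zero single add]:
  fixes p :: "'a \<Rightarrow>\<^sub>0 'b::comm_monoid_add"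
  assumes "P 0" and "\<And>m c. P (Poly_Mapping.single m c)" and "\<And>p q. P p \<Longrightarrow> P q \<Longrightarrow> P (p + q)"
  shows "P p"
proof -
  \<comment> \<open>The index set is an arbitrary \<open>A\<close>, so that the induction on it
    leaves \<open>p\<close> fixed. For infinite \<open>A\<close> the sum defaults to 0.\<close>
  have "P (\<Sum>m\<in>A. Poly_Mapping.single m (Poly_Mapping.lookup p m))" for A
    by (induction A rule: infinite_finite_induct) (auto intro: assms)
  then show ?thesis by (subst poly_mapping_eq_sum_single)
qed

section \<open>The collapsing homomorphism\<close>

text \<open>
  The homomorphism \<open>x, z \<mapsto> t s\<close>, \<open>y \<mapsto> s\<close> into \<open>\<real>[t][s]\<close>: it sets \<open>z = x\<close> and \<open>y = 1\<close>, while \<open>s\<close> records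
  the total degree.
\<close>

definition collapse :: "rpoly \<Rightarrow> real poly poly"
  where "collapse p = (\<Sum>m\<in>Poly_Mapping.keys p.
    Polynomial.monom (Polynomial.monom (Poly_Mapping.lookup p m)
      (Poly_Mapping.lookup m 0 + Poly_Mapping.lookup m 2)) (total_degree m))"

lemma collapse_zero [simp]: "collapse 0 = 0"
  by (simp add: collapse_def)

lemma collapse_single [simp]:
  "collapse (Poly_Mapping.single m c) =
    Polynomial.monom (Polynomial.monom c (Poly_Mapping.lookup m 0 + Poly_Mapping.lookup m 2))
      (total_degree m)"
  by (simp add: collapse_def)

lemma collapse_add [simp]: "collapse (p + q) = collapse p + collapse q"
  unfolding collapse_def by (rule setsum_keys_plus_distrib) (simp_all add: add_monom)

lemma collapse_mult [simp]: "collapse (p * q) = collapse p * collapse q"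
proof (induction p rule: poly_mapping_additive_induct)
  case (single m c)
  show ?case
    by (induction q rule: poly_mapping_additive_induct)
      (simp_all add: mult_single mult_monom lookup_add algebra_simps)
qed (simp_all add: algebra_simps)

lemma collapse_one [simp]: "collapse 1 = 1"
  by (simp add: single_one [symmetric] del: single_one)

lemma collapse_power [simp]: "collapse (p ^ n) = collapse p ^ n"
  by (induction n) simp_all

lemma collapse_vx: "collapse vx = Polynomial.monom (Polynomial.monom 1 1) 1"
  by (simp add: vx_def var_def lookup_single when_def)

lemma collapse_vy: "collapse vy = Polynomial.monom 1 1"
  by (simp add: vy_def var_def lookup_single when_def)

lemma collapse_vz: "collapse vz = collapse vx"
  by (simp add: vx_def vz_def var_def lookup_single when_def)

lemma collapse_vx_plus_vy: "collapse (vx + vy) = Polynomial.monom [:1, 1:] 1"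
  by (simp add: collapse_vx collapse_vy add_monom monom_altdef one_pCons)

text \<open>The exponent of \<open>t\<close> in the image of a monomial counts only \<open>x\<close>
  and \<open>z\<close>, while that of \<open>s\<close> counts all variables. This supplies the
  degree bound on \<open>b\<close> even when the coefficients of a membership relation are not
  homogeneous.\<close>

lemma degree_coeff_collapse_le:
  "Polynomial.degree (Polynomial.coeff (collapse p) k) \<le> k"
  unfolding collapse_def coeff_sum
proof (rule degree_sum_le)
  fix m
  show "Polynomial.degree (Polynomial.coeff (Polynomial.monom
    (Polynomial.monom (Poly_Mapping.lookup p m)
      (Poly_Mapping.lookup m 0 + Poly_Mapping.lookup m 2)) (total_degree m)) k) \<le> k"
    using lookup_02_le_total_degree [of m]
    by (auto intro: order.trans [OF degree_monom_le])
qed simp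

section \<open>Univariate non-membership, with \<open>n = r - 1\<close>\<close>

lemma monom_neq_combination:
  fixes a b :: "real poly"
  assumes deg: "Polynomial.degree b \<le> n"
  shows "Polynomial.monom 1 n \<noteq> a * Polynomial.monom 1 (n + 2) + b * [:1, 1:] ^ (n + 2)"
proof
  assume eq: "Polynomial.monom 1 n = a * Polynomial.monom 1 (n + 2) + b * [:1, 1:] ^ (n + 2)"
  have X: "Polynomial.monom 1 (n + 2) = Polynomial.monom (1::real) n * Polynomial.monom 1 2"
    by (simp add: mult_monom)
  have "b * [:1, 1:] ^ (n + 2) = Polynomial.monom 1 n * (1 - a * Polynomial.monom 1 2)"
    using eq unfolding X by (simp add: algebra_simps)
  then have dvd: "Polynomial.monom 1 n dvd b * [:1, 1:] ^ (n + 2)" by simp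
  have "coprime (Polynomial.monom 1 n) ([:1, 1:] ^ (n + 2) :: real poly)"
  proof -
    have "coprime [:0, 1:] ([:1, 1:] :: real poly)"
    proof (rule coprimeI)
      fix c :: "real poly"
      assume "c dvd [:0, 1:]" "c dvd [:1, 1:]"
      then have "c dvd [:1, 1:] - [:0, 1:]" by (rule dvd_diff [rotated])
      then show "is_unit c" by (simp add: one_pCons)
    qed
    then show ?thesis
      by (simp only: monom_altdef smult_1_left coprime_power_left_iff coprime_power_right_iff simp_thms)
  qed
  with dvd have "Polynomial.monom 1 n dvd b"
    by (simp add: coprime_dvd_mult_left_iff)
  then obtain c where c: "b = Polynomial.monom 1 n * c" by blast
  \<comment> \<open>The degree bound on \<open>b\<close> is fully used up by the factor
    \<open>t^n\<close>.\<close>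
  have "Polynomial.degree c = 0"
  proof (cases "c = 0")
    case False
    then have "Polynomial.degree b = n + Polynomial.degree c"
      by (simp add: c degree_mult_eq degree_monom_eq)
    with deg show ?thesis by simp
  qed simp
  then obtain c0 where c0: "c = [:c0:]" by (rule degree_eq_zeroE)
  have "Polynomial.monom 1 n * 1 =
      Polynomial.monom 1 n * (a * Polynomial.monom 1 2 + c * [:1, 1:] ^ (n + 2))"
    using eq unfolding X c by (simp add: algebra_simps)
  then have one: "1 = a * Polynomial.monom 1 2 + c * [:1, 1:] ^ (n + 2)"
    by (subst (asm) mult_left_cancel) simp_all
  from arg_cong [OF one, of "\<lambda>p. poly p 0"] have "c0 = 1"
    by (simp add: c0 poly_monom)
  \<comment> \<open>The derivative at 0 reads off the linear coefficient: 0 on the left,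
    \<open>(n + 2) * c0\<close> on the right.\<close>
  moreover from arg_cong [OF one, of "\<lambda>p. poly (pderiv p) 0"] have "c0 = 0"
    by (simp add: c0 pderiv_mult pderiv_add pderiv_monom poly_monom pderiv_smult pderiv_power
        pderiv_pCons del: power_Suc)
  ultimately show False by simp
qed

section \<open>The colon ideal containing all four coefficients\<close>

text \<open>The preimage, under the substitution \<open>z = x\<close>, of the colon ideal of
  \<open>\<langle>x^(r+1), (x+y)^(r+1)\<rangle>\<close> by \<open>y^(r+1)\<close> in
  \<open>\<real>[x,y]\<close>. The coefficients are images under \<open>collapse\<close>, not
  arbitrary elements of \<open>\<real>[t][s]\<close>, so the degree bound applies to them.\<close>

definition collapsed_colon :: "nat \<Rightarrow> rpoly set"
  where "collapsed_colon r = {p. \<exists>a b. collapse (p * vy ^ (r + 1)) =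
    collapse (a * vx ^ (r + 1) + b * (vx + vy) ^ (r + 1))}"

lemma vx_power_not_in_collapsed_colon:
  assumes "r \<ge> 1"
  shows "vx ^ (r - 1) \<notin> collapsed_colon r"
proof
  assume "vx ^ (r - 1) \<in> collapsed_colon r"
  then obtain a b where "collapse (vx ^ (r - 1) * vy ^ (r + 1)) =
      collapse (a * vx ^ (r + 1) + b * (vx + vy) ^ (r + 1))"
    unfolding collapsed_colon_def by blast
  \<comment> \<open>The exponents of \<open>s\<close> on the left add up to
    \<open>(r - 1) + (r + 1) = 2 * r\<close>, where \<open>r \<ge> 1\<close> guards the truncated
    subtraction.\<close>
  then have eq: "Polynomial.monom (Polynomial.monom 1 (r - 1)) (2 * r) =
      Polynomial.monom (Polynomial.monom 1 (r + 1)) (r + 1) * collapse a +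
      Polynomial.monom ([:1, 1:] ^ (r + 1)) (r + 1) * collapse b"
    unfolding collapse_add [of "_ * _"] collapse_mult collapse_power collapse_vx collapse_vy
      collapse_vx_plus_vy monom_power
    using assms by (simp add: mult_monom mult_2_right mult.commute del: power_Suc)
  define n where "n = r - 1"
  have r: "r = n + 1" using assms by (simp add: n_def)
  \<comment> \<open>Taking the coefficient of \<open>s^(2r)\<close> plays the role of passing to a
    homogeneous component. Both generators carry \<open>s^(r+1)\<close>, so \<open>a\<close> and
    \<open>b\<close> contribute their parts of degree \<open>2r - (r+1) = n\<close>.\<close>
  from arg_cong [OF eq, of "\<lambda>p. Polynomial.coeff p (2 * r)"]
  have "Polynomial.monom 1 n = Polynomial.coeff (collapse a) n * Polynomial.monom 1 (n + 2) +
      Polynomial.coeff (collapse b) n * [:1, 1:] ^ (n + 2)"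
    by (simp add: coeff_monom_mult r del: power_Suc)
  with monom_neq_combination [OF degree_coeff_collapse_le] show False by blast
qed

lemma carrier_Rxyz [simp]: "carrier Rxyz = UNIV"
  and mult_Rxyz [simp]: "x \<otimes>\<^bsub>Rxyz\<^esub> y = x * y"
  and add_Rxyz [simp]: "x \<oplus>\<^bsub>Rxyz\<^esub> y = x + y"
  and one_Rxyz [simp]: "\<one>\<^bsub>Rxyz\<^esub> = 1"
  and zero_Rxyz [simp]: "\<zero>\<^bsub>Rxyz\<^esub> = 0"
  by (simp_all add: ring_of_type_algebra_def)

text \<open>Negation is multiplication by -1 and the product commutes, so these closure properties
  yield an additive subgroup that absorbs on both sides.\<close>

lemma ideal_RxyzI:
  assumes "0 \<in> I" and add: "\<And>p q. p \<in> I \<Longrightarrow> q \<in> I \<Longrightarrow> p + q \<in> I"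
    and mult: "\<And>p q. p \<in> I \<Longrightarrow> q * p \<in> I"
  shows "ideal I Rxyz"
proof -
  interpret cring Rxyz by (rule cring_from_type_algebra)
  have minus: "- p \<in> I" if "p \<in> I" for p
    using mult [OF that, of "- 1"] by simp
  have mult_right: "p * q \<in> I" if "p \<in> I" for p q
    using mult [OF that, of q] by (simp add: mult.commute)
  have inv: "\<ominus>\<^bsub>Rxyz\<^esub> p = - p" for p
    by (rule minus_equality) simp_all
  show ?thesis
  proof (rule idealI)
    show "subgroup I (add_monoid Rxyz)"
    proof (rule add.subgroupI)
      show "I \<noteq> {}" using assms(1) by blast
    qed (simp_all add: add minus inv)
  qed (simp_all add: mult mult_right ring_axioms)
qed

lemma ideal_collapsed_colon: "ideal (collapsed_colon r) Rxyz"
proof (rule ideal_RxyzI)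
  show "0 \<in> collapsed_colon r"
    unfolding collapsed_colon_def by (auto intro!: exI [of _ 0])
next
  fix p q
  assume "p \<in> collapsed_colon r" "q \<in> collapsed_colon r"
  then obtain a b a' b' where
    "collapse (p * vy ^ (r + 1)) = collapse (a * vx ^ (r + 1) + b * (vx + vy) ^ (r + 1))"
    "collapse (q * vy ^ (r + 1)) = collapse (a' * vx ^ (r + 1) + b' * (vx + vy) ^ (r + 1))"
    unfolding collapsed_colon_def by blast
  then have "collapse ((p + q) * vy ^ (r + 1)) =
      collapse ((a + a') * vx ^ (r + 1) + (b + b') * (vx + vy) ^ (r + 1))"
    unfolding distrib_right collapse_add by (simp only: ac_simps)
  then show "p + q \<in> collapsed_colon r" unfolding collapsed_colon_def by blast
next
  fix p q
  assume "p \<in> collapsed_colon r"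
  then obtain a b where
    "collapse (p * vy ^ (r + 1)) = collapse (a * vx ^ (r + 1) + b * (vx + vy) ^ (r + 1))"
    unfolding collapsed_colon_def by blast
  then have "collapse (q * p * vy ^ (r + 1)) =
      collapse (q * a * vx ^ (r + 1) + q * b * (vx + vy) ^ (r + 1))"
    unfolding mult.assoc distrib_left [symmetric] collapse_mult [of q] by (rule arg_cong)
  then show "q * p \<in> collapsed_colon r" unfolding collapsed_colon_def by blast
qed

text \<open>Solving the syzygy relation for its last term exhibits the membership. Leaving
  \<open>g\<close> and \<open>h\<close> open up to \<open>collapse\<close> covers both
  \<open>x, x+y\<close> and \<open>z, z+y\<close>.\<close>

lemma syzygy_in_collapsed_colon:
  assumes syz: "(A, B, C) \<in> syzygies (g ^ (r + 1), h ^ (r + 1), vy ^ (r + 1))"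
    and "collapse g = collapse vx" "collapse h = collapse (vx + vy)"
  shows "C \<in> collapsed_colon r"
proof -
  from syz have "C * vy ^ (r + 1) = (- A) * g ^ (r + 1) + (- B) * h ^ (r + 1)"
    unfolding syzygies_def by (simp add: algebra_simps add_eq_0_iff)
  then have "collapse (C * vy ^ (r + 1)) =
      collapse ((- A) * vx ^ (r + 1) + (- B) * (vx + vy) ^ (r + 1))"
    by (simp only: collapse_add [of "_ * _"] collapse_mult collapse_power assms(2,3))
  then show ?thesis unfolding collapsed_colon_def by blast
qed

lemma homogeneous_syzygy_basis_in_syzygies:
  assumes "homogeneous_syzygy_basis g u v"
  shows "u \<in> syzygies g" "v \<in> syzygies g"
  using assms column.span_superset [of "{u, v}"] unfolding homogeneous_syzygy_basis_def by auto

section \<open>Graded pieces of the quotient and their dimension\<close>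

lemma finite_monomials_of_degree: "finite {m. total_degree m = k}"
proof -
  have "{m. total_degree m = k} \<subseteq> Poly_Mapping.Abs_poly_mapping ` (UNIV \<rightarrow>\<^sub>E {..k})"
  proof
    fix m
    assume "m \<in> {m. total_degree m = k}"
    then have "Poly_Mapping.lookup m i \<le> k" for i
      unfolding total_degree_def by (auto intro: member_le_sum)
    then have "Poly_Mapping.lookup m \<in> UNIV \<rightarrow>\<^sub>E {..k}" by auto
    then show "m \<in> Poly_Mapping.Abs_poly_mapping ` (UNIV \<rightarrow>\<^sub>E {..k})"
      by (metis imageI lookup_inverse)
  qed
  then show ?thesis by (rule finite_subset) (simp add: finite_PiE)
qed

text \<open>The class of \<open>p\<close> is a nonzero element of the piece. The work lies in finite
  dimensionality: only then does the value 0 of \<open>dim\<close> force the piece to be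
  trivial.\<close>

lemma hilbert_function_quotient_nonzero:
  assumes J: "ideal J Rxyz" and p: "p \<in> graded_piece k" "p \<notin> J"
  shows "hilbert_function_quotient J k \<noteq> 0"
proof
  assume hf: "hilbert_function_quotient J k = 0"
  interpret ideal J Rxyz by (rule J)
  define Q where "Q = Rxyz Quot J"
  interpret \<pi>: ring_hom_ring Rxyz Q "(+>\<^bsub>Rxyz\<^esub>) J"
    unfolding Q_def by (rule rcos_ring_hom_ring)
  define \<pi> where "\<pi> = (+>\<^bsub>Rxyz\<^esub>) J"
  define K where "K = range (\<lambda>c. \<pi> (const_poly c))"
  have \<pi>_hom: "\<pi> (f + g) = \<pi> f \<oplus>\<^bsub>Q\<^esub> \<pi> g" "\<pi> (f * g) = \<pi> f \<otimes>\<^bsub>Q\<^esub> \<pi> g"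
    "\<pi> 0 = \<zero>\<^bsub>Q\<^esub>" "\<pi> 1 = \<one>\<^bsub>Q\<^esub>" "\<pi> f \<in> carrier Q" for f g
    using \<pi>.hom_add [of f g] \<pi>.hom_mult [of f g] \<pi>.hom_zero \<pi>.hom_one \<pi>.hom_closed [of f]
    by (simp_all add: \<pi>_def)
  \<comment> \<open>The zero of the quotient is \<open>J\<close> itself, and \<open>f\<close> lies
    in its own coset.\<close>
  have \<pi>_zero: "f \<in> J" if "\<pi> f = \<zero>\<^bsub>Q\<^esub>" for f
    using that a_rcos_self [of f] unfolding \<pi>_def Q_def FactRing_def by simp
  \<comment> \<open>\<open>J\<close> is proper because it misses \<open>p\<close>; hence the real
    scalars embed as a field \<open>K\<close>.\<close>
  have nontrivial: "\<one>\<^bsub>Q\<^esub> \<noteq> \<zero>\<^bsub>Q\<^esub>"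
  proof
    assume "\<one>\<^bsub>Q\<^esub> = \<zero>\<^bsub>Q\<^esub>"
    then have "1 \<in> J" using \<pi>_zero [of 1] by (simp add: \<pi>_hom)
    then show False using I_l_closed [of 1 p] p(2) by simp
  qed
  have K: "subfield K Q"
  proof -
    interpret real: Ring.field "ring_of_type_algebra :: real ring"
      by (rule field_from_type_algebra)
    interpret c: ring_hom_ring "ring_of_type_algebra :: real ring" Q "\<lambda>c. \<pi> (const_poly c)"
    proof (rule ring_hom_ringI2)
      show "(\<lambda>c. \<pi> (const_poly c)) \<in> ring_hom (ring_of_type_algebra :: real ring) Q"
        by (rule ring_hom_memI)
          (simp_all add: \<pi>_hom(1-4) [symmetric] ring_of_type_algebra_def const_poly_def
            single_add mult_single \<pi>_hom(5))
    qed (rule real.ring_axioms \<pi>.S.ring_axioms)+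
    show ?thesis
      using c.img_is_subfield(2) [OF real.carrier_is_subfield nontrivial]
      by (simp add: K_def ring_of_type_algebra_def)
  qed
  \<comment> \<open>Stated for any list of monomials to allow induction; it will be applied to a
    list of all monomials of degree \<open>k\<close>, which shows that the piece is finitely
    spanned.\<close>
  have span: "\<pi>.S.Span K (map (\<lambda>m. \<pi> (Poly_Mapping.single m 1)) ms) =
      \<pi> ` {f. Poly_Mapping.keys f \<subseteq> set ms}" for ms
  proof (induction ms)
    case Nil
    show ?case by (simp add: \<pi>_hom)
  next
    case (Cons m ms)
    show ?case
    proof (intro equalityI subsetI)
      fix u
      assume "u \<in> \<pi>.S.Span K (map (\<lambda>m. \<pi> (Poly_Mapping.single m 1)) (m # ms))"
      then obtain c f where f: "Poly_Mapping.keys f \<subseteq> set ms"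
        and u: "u = \<pi> (const_poly c) \<otimes>\<^bsub>Q\<^esub> \<pi> (Poly_Mapping.single m 1) \<oplus>\<^bsub>Q\<^esub> \<pi> f"
        using Cons.IH by (auto simp: \<pi>.S.line_extension_mem_iff K_def)
      have "u = \<pi> (Poly_Mapping.single m c + f)"
        by (simp add: u \<pi>_hom(1,2) [symmetric] const_poly_def mult_single)
      moreover have "Poly_Mapping.keys (Poly_Mapping.single m c + f) \<subseteq> set (m # ms)"
        using f keys_add [of "Poly_Mapping.single m c" f] by (auto split: if_splits)
      ultimately show "u \<in> \<pi> ` {f. Poly_Mapping.keys f \<subseteq> set (m # ms)}" by blast
    next
      fix u
      assume "u \<in> \<pi> ` {f. Poly_Mapping.keys f \<subseteq> set (m # ms)}"
      then obtain f where f: "Poly_Mapping.keys f \<subseteq> set (m # ms)" and u: "u = \<pi> f" by blast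
      \<comment> \<open>\<open>g\<close> is \<open>f\<close> without its \<open>m\<close>-term; the
        removed coefficient becomes the scalar of the line extension.\<close>
      define g where "g = f - Poly_Mapping.single m (Poly_Mapping.lookup f m)"
      have "m \<notin> Poly_Mapping.keys g"
        by (simp add: g_def in_keys_iff lookup_minus)
      moreover have "Poly_Mapping.keys g \<subseteq> Poly_Mapping.keys f \<union> {m}"
        unfolding g_def using keys_diff by (fastforce split: if_splits)
      ultimately have "Poly_Mapping.keys g \<subseteq> set ms" using f by auto
      moreover have "u = \<pi> (const_poly (Poly_Mapping.lookup f m)) \<otimes>\<^bsub>Q\<^esub> \<pi> (Poly_Mapping.single m 1) \<oplus>\<^bsub>Q\<^esub> \<pi> g"
        by (simp add: u g_def \<pi>_hom(1,2) [symmetric] const_poly_def mult_single)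
      ultimately show "u \<in> \<pi>.S.Span K (map (\<lambda>m. \<pi> (Poly_Mapping.single m 1)) (m # ms))"
        using Cons.IH by (auto simp: \<pi>.S.line_extension_mem_iff K_def)
    qed
  qed
  obtain ms where ms: "set ms = {m. total_degree m = k}"
    using finite_list [OF finite_monomials_of_degree] by blast
  have piece: "quotient_graded_piece J k = \<pi> ` {f. Poly_Mapping.keys f \<subseteq> set ms}"
    by (auto simp: quotient_graded_piece_def graded_piece_def total_degree_def ms \<pi>_def)
  have "\<pi>.S.finite_dimension K (quotient_graded_piece J k)"
    unfolding piece span [symmetric]
    by (rule \<pi>.S.Span_finite_dimension [OF K]) (auto simp: \<pi>_hom)
  then have "\<pi>.S.dimension (\<pi>.S.dim K (quotient_graded_piece J k)) K (quotient_graded_piece J k)"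
    using \<pi>.S.finite_dimensionE [OF K] by (simp add: over_def)
  moreover have "\<pi>.S.dim K (quotient_graded_piece J k) = 0"
    using hf by (simp add: hilbert_function_quotient_def Q_def K_def \<pi>_def)
  ultimately have "quotient_graded_piece J k = {\<zero>\<^bsub>Q\<^esub>}"
    using \<pi>.S.dimension_zero [OF K] by simp
  then have "\<pi> p = \<zero>\<^bsub>Q\<^esub>"
    using p(1) by (auto simp: quotient_graded_piece_def \<pi>_def)
  then show False using \<pi>_zero p(2) by blast
qed

section \<open>The witness \<open>x^(r-1)\<close> and the conclusion\<close>

lemma vx_power_in_graded_piece: "vx ^ n \<in> graded_piece n"
proof -
  have "vx ^ n = Poly_Mapping.single (Poly_Mapping.single 0 n) 1"
    by (induction n) (simp_all add: vx_def var_def mult_single flip: single_add)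
  then show ?thesis
    by (simp add: graded_piece_def total_degree_def [symmetric])
qed

theorem mainTheorem2:
  fixes r :: nat
    and A1 B1 C1 D1 E1 F1 A2 B2 C2 D2 E2 F2 :: rpoly
  assumes "r \<ge> 1"
    and "homogeneous_syzygy_basis (vx ^ (r + 1), (vx + vy) ^ (r + 1), vy ^ (r + 1))
           (A1, B1, C1) (D1, E1, F1)"
    and "homogeneous_syzygy_basis (vz ^ (r + 1), (vz + vy) ^ (r + 1), vy ^ (r + 1))
           (A2, B2, C2) (D2, E2, F2)"
  shows "hilbert_function_quotient (Idl\<^bsub>Rxyz\<^esub> {C1, F1, C2, F2}) (r - 1) \<noteq> 0"
proof -
  interpret cring Rxyz by (rule cring_from_type_algebra)
  note syz = homogeneous_syzygy_basis_in_syzygies [OF assms(2)]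
    homogeneous_syzygy_basis_in_syzygies [OF assms(3)]
  \<comment> \<open>The second pair qualifies because \<open>collapse\<close> identifies
    \<open>vz\<close> with \<open>vx\<close>.\<close>
  have "{C1, F1, C2, F2} \<subseteq> collapsed_colon r"
    using syz [THEN syzygy_in_collapsed_colon] by (simp add: collapse_vz)
  then have "Idl\<^bsub>Rxyz\<^esub> {C1, F1, C2, F2} \<subseteq> collapsed_colon r"
    by (rule genideal_minimal [OF ideal_collapsed_colon])
  then have "vx ^ (r - 1) \<notin> Idl\<^bsub>Rxyz\<^esub> {C1, F1, C2, F2}"
    using vx_power_not_in_collapsed_colon [OF assms(1)] by blast
  moreover have "ideal (Idl\<^bsub>Rxyz\<^esub> {C1, F1, C2, F2}) Rxyz"
    by (rule genideal_ideal) simp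
  ultimately show ?thesis
    using hilbert_function_quotient_nonzero vx_power_in_graded_piece by blast
qed

end
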